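(* Let $\Delta y=\Delta x>0$. The multi-dimensionally extended version of the collocated sequential explicit scheme with central derivatives for the two-dimensional Maxwell equations, given in the context, is stable (in the von Neumann sense given in the context) for $\mathrm{CFL}:=\frac{\Delta t}{\Delta x}<2$.
   Context: The system is $\partial_tB^z=-(\partial_xE^y-\partial_yE^x)$, $\partial_tE^x=\partial_yB^z$, $\partial_tE^y=-\partial_xB^z$ on a Cartesian grid with spacings $\Delta x,\Delta y$, cells $(i,j)\in\mathbb Z^2$ and time step $\Delta t>0$. Averaging operators: $\langle q_i\rangle_j:=\frac{q_{i,j+1}+2q_{ij}+q_{i,j-1}}4$, $\langle q_{\cdot,j}\rangle_i:=\frac{q_{i+1,j}+2q_{ij}+q_{i-1,j}}4$. *Scheme*: $$\frac{(B^z)^{n+1}_{ij}-(B^z)^n_{ij}}{\Delta t}=-\left(\frac{\langle(E^y)^n_{i+1}\rangle_j-\langle(E^y)^n_{i-1}\rangle_j}{2\Delta x}-\frac{\langle(E^x)^n_{\cdot,j+1}\rangle_i-\langle(E^x)^n_{\cdot,j-1}\rangle_i}{2\Delta y}\right),$$ $$\frac{(E^x)^{n+1}_{ij}-(E^x)^n_{ij}}{\Delta t}=\frac{\langle(B^z)^{n+1}_{\cdot,j+1}\rangle_i-\langle(B^z)^{n+1}_{\cdot,j-1}\rangle_i}{2\Delta y},\qquad \frac{(E^y)^{n+1}_{ij}-(E^y)^n_{ij}}{\Delta t}=-\frac{\langle(B^z)^{n+1}_{i+1}\rangle_j-\langle(B^z)^{n+1}_{i-1}\rangle_j}{2\Delta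 x}.$$ *Stability*: inserting $q^n_{ij}=\hat q^n\exp(\mathrm i\beta_xi+\mathrm i\beta_yj)$ for $q=(B^z,E^x,E^y)$ and eliminating $(B^z)^{n+1}$ from the right-hand sides gives $\hat q^{n+1}=\mathcal A(\beta_x,\beta_y)\hat q^n$ with a $3\times3$ matrix $\mathcal A$. The scheme is stable if for all $\beta_x,\beta_y\in\mathbb R$ all eigenvalues of $\mathcal A(\beta_x,\beta_y)$ lie in the closed unit disc. *)

theory Defs
  imports "Jordan_Normal_Form.Char_Poly"
begin

text \<open>Grid functions are complex valued, since Fourier modes are inserted into the scheme;
  \<open>B\<^sub>z n i j\<close> is the value in the cell \<open>(i, j)\<close> at time level \<open>n\<close>.\<close>

type_synonym grid_fun = "int \<Rightarrow> int \<Rightarrow> complex"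

text \<open>The average and the central difference act on the one index direction in which the
  argument is abstracted.\<close>

definition avg :: "(int \<Rightarrow> complex) \<Rightarrow> int \<Rightarrow> complex" where
  "avg q k = (q (k + 1) + 2 * q k + q (k - 1)) / 4"

definition cdiff :: "real \<Rightarrow> (int \<Rightarrow> complex) \<Rightarrow> int \<Rightarrow> complex" where
  "cdiff h q k = (q (k + 1) - q (k - 1)) / (2 * of_real h)"

definition Dx :: "real \<Rightarrow> grid_fun \<Rightarrow> grid_fun" where
  "Dx dx q i j = cdiff dx (\<lambda>i'. avg (\<lambda>j'. q i' j') j) i"

definition Dy :: "real \<Rightarrow> grid_fun \<Rightarrow> grid_fun" where
  "Dy dy q i j = cdiff dy (\<lambda>j'. avg (\<lambda>i'. q i' j') i) j"

definition scheme ::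
  "real \<Rightarrow> real \<Rightarrow> real \<Rightarrow> (nat \<Rightarrow> grid_fun) \<Rightarrow> (nat \<Rightarrow> grid_fun) \<Rightarrow> (nat \<Rightarrow> grid_fun) \<Rightarrow> bool" where
  "scheme dt dx dy B\<^sub>z E\<^sub>x E\<^sub>y \<longleftrightarrow> (\<forall>n i j.
     (B\<^sub>z (Suc n) i j - B\<^sub>z n i j) / of_real dt = - (Dx dx (E\<^sub>y n) i j - Dy dy (E\<^sub>x n) i j) \<and>
     (E\<^sub>x (Suc n) i j - E\<^sub>x n i j) / of_real dt = Dy dy (B\<^sub>z (Suc n)) i j \<and>
     (E\<^sub>y (Suc n) i j - E\<^sub>y n i j) / of_real dt = - Dx dx (B\<^sub>z (Suc n)) i j)"

definition fourier_mode :: "real \<Rightarrow> real \<Rightarrow> complex \<Rightarrow> grid_fun" where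
  "fourier_mode \<beta>x \<beta>y a i j =
     a * exp (\<i> * of_real \<beta>x * of_int i + \<i> * of_real \<beta>y * of_int j)"

text \<open>The components of the amplitude vector are ordered as \<open>(B\<^sub>z, E\<^sub>x, E\<^sub>y)\<close>. The matrix is specified
  by what inserting Fourier modes into the scheme amounts to; it is unique for \<open>dt \<noteq> 0\<close>, see
  \<open>ex1_amplification_matrix\<close> below.\<close>

definition is_amplification_matrix ::
  "real \<Rightarrow> real \<Rightarrow> real \<Rightarrow> real \<Rightarrow> real \<Rightarrow> complex mat \<Rightarrow> bool" where
  "is_amplification_matrix dt dx dy \<beta>x \<beta>y A \<longleftrightarrow>
     A \<in> carrier_mat 3 3 \<and>
     (\<forall>q :: nat \<Rightarrow> complex vec. (\<forall>n. q n \<in> carrier_vec 3) \<longrightarrow>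
        (scheme dt dx dy
           (\<lambda>n. fourier_mode \<beta>x \<beta>y (q n $ 0))
           (\<lambda>n. fourier_mode \<beta>x \<beta>y (q n $ 1))
           (\<lambda>n. fourier_mode \<beta>x \<beta>y (q n $ 2))
         \<longleftrightarrow> (\<forall>n. q (Suc n) = A *\<^sub>v q n)))"

definition amplification_matrix ::
  "real \<Rightarrow> real \<Rightarrow> real \<Rightarrow> real \<Rightarrow> real \<Rightarrow> complex mat" where
  "amplification_matrix dt dx dy \<beta>x \<beta>y = (THE A. is_amplification_matrix dt dx dy \<beta>x \<beta>y A)"

definition von_neumann_stable :: "real \<Rightarrow> real \<Rightarrow> real \<Rightarrow> bool" where
  "von_neumann_stable dt dx dy \<longleftrightarrow>
     (\<forall>\<beta>x \<beta>y \<mu>. eigenvalue (amplification_matrix dt dx dy \<beta>x \<beta>y) \<mu> \<longrightarrow> cmod \<mu> \<le> 1)"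

text \<open>Fourier symbol of \<open>Dx\<close>; that of \<open>Dy\<close> arises by swapping the roles of the two directions.\<close>

definition symx :: "real \<Rightarrow> real \<Rightarrow> real \<Rightarrow> complex" where
  "symx dx \<beta>x \<beta>y = (exp (\<i> * of_real \<beta>x) - exp (- (\<i> * of_real \<beta>x))) / (2 * of_real dx)
     * ((exp (\<i> * of_real \<beta>y) + 2 + exp (- (\<i> * of_real \<beta>y))) / 4)"

lemma fourier_mode_shift:
  "fourier_mode \<beta>x \<beta>y a (i + 1) j = exp (\<i> * of_real \<beta>x) * fourier_mode \<beta>x \<beta>y a i j"
  "fourier_mode \<beta>x \<beta>y a (i - 1) j = exp (- (\<i> * of_real \<beta>x)) * fourier_mode \<beta>x \<beta>y a i j"
  "fourier_mode \<beta>x \<beta>y a i (j + 1) = exp (\<i> * of_real \<beta>y) * fourier_mode \<beta>x \<beta>y a i j"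
  "fourier_mode \<beta>x \<beta>y a i (j - 1) = exp (- (\<i> * of_real \<beta>y)) * fourier_mode \<beta>x \<beta>y a i j"
  unfolding fourier_mode_def
  by (simp_all only: mult.left_commute[of "exp _" a] flip: exp_add)
    (simp_all add: algebra_simps)

lemma avg_geometric:
  assumes "q (k + 1) = g * q k" "q (k - 1) = h * q k"
  shows "avg q k = (g + 2 + h) / 4 * q k"
  unfolding avg_def assms by (simp add: distrib_right)

lemma cdiff_geometric:
  assumes "q (k + 1) = g * q k" "q (k - 1) = h * q k"
  shows "cdiff d q k = (g - h) / (2 * of_real d) * q k"
  unfolding cdiff_def assms by (simp add: left_diff_distrib)

lemma Dx_fourier_mode:
  "Dx dx (fourier_mode \<beta>x \<beta>y a) i j = symx dx \<beta>x \<beta>y * fourier_mode \<beta>x \<beta>y a i j"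
proof -
  have "avg (\<lambda>j'. fourier_mode \<beta>x \<beta>y a i' j') j =
      (exp (\<i> * of_real \<beta>y) + 2 + exp (- (\<i> * of_real \<beta>y))) / 4 * fourier_mode \<beta>x \<beta>y a i' j" for i'
    by (rule avg_geometric) (rule fourier_mode_shift)+
  moreover have "cdiff dx (\<lambda>i'. c * fourier_mode \<beta>x \<beta>y a i' j) i =
      (exp (\<i> * of_real \<beta>x) - exp (- (\<i> * of_real \<beta>x))) / (2 * of_real dx)
        * (c * fourier_mode \<beta>x \<beta>y a i j)" for c
    by (rule cdiff_geometric) (simp_all only: fourier_mode_shift mult.left_commute)
  ultimately show ?thesis
    by (simp only: Dx_def symx_def mult.assoc)
qed

lemma Dy_fourier_mode:
  "Dy dy (fourier_mode \<beta>x \<beta>y a) i j = symx dy \<beta>y \<beta>x * fourier_mode \<beta>x \<beta>y a i j"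
proof -
  have "fourier_mode \<beta>x \<beta>y a i' j' = fourier_mode \<beta>y \<beta>x a j' i'" for i' j'
    by (simp add: fourier_mode_def add.commute)
  then have "Dy dy (fourier_mode \<beta>x \<beta>y a) i j = Dx dy (fourier_mode \<beta>y \<beta>x a) j i"
      and "fourier_mode \<beta>x \<beta>y a i j = fourier_mode \<beta>y \<beta>x a j i"
    by (simp_all only: Dx_def Dy_def)
  then show ?thesis by (simp only: Dx_fourier_mode)
qed

lemma scheme_fourier_mode:
  assumes "dt \<noteq> 0"
  shows "scheme dt dx dy (\<lambda>n. fourier_mode \<beta>x \<beta>y (b n)) (\<lambda>n. fourier_mode \<beta>x \<beta>y (ex n))
           (\<lambda>n. fourier_mode \<beta>x \<beta>y (ey n)) \<longleftrightarrow>
         (\<forall>n. b (Suc n) = b n - (of_real dt * symx dx \<beta>x \<beta>y * ey n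
                            - of_real dt * symx dy \<beta>y \<beta>x * ex n) \<and>
              ex (Suc n) = ex n + of_real dt * symx dy \<beta>y \<beta>x * b (Suc n) \<and>
              ey (Suc n) = ey n - of_real dt * symx dx \<beta>x \<beta>y * b (Suc n))"
proof -
  define E where "E = (\<lambda>i j. exp (\<i> * of_real \<beta>x * of_int i + \<i> * of_real \<beta>y * of_int j))"
  have E: "E i j \<noteq> 0" for i j by (simp add: E_def)
  have m: "fourier_mode \<beta>x \<beta>y a i j = a * E i j" for a i j
    by (simp add: fourier_mode_def E_def)
  have c: "(x' * e - x * e) / of_real dt = r * e \<longleftrightarrow> x' = x + of_real dt * r"
    if "e \<noteq> 0" for x x' r e :: complex
  proof -
    have "(x' * e - x * e) / of_real dt = r * e \<longleftrightarrow> x' * e - x * e = r * e * of_real dt"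
      using assms by (simp add: divide_eq_eq)
    also have "\<dots> \<longleftrightarrow> (x' - x) * e = (of_real dt * r) * e"
      by (simp add: algebra_simps)
    also have "\<dots> \<longleftrightarrow> x' - x = of_real dt * r" using that by simp
    finally show ?thesis by (simp add: diff_eq_eq add.commute)
  qed
  have r1: "- (k * (u * e) - l * (v * e)) = (l * v - k * u) * e" for k l u v e :: complex
    by (simp add: algebra_simps)
  have e1: "(x' * E i j - x * E i j) / of_real dt
      = - (k * (u * E i j) - l * (v * E i j)) \<longleftrightarrow> x' = x - (of_real dt * k * u - of_real dt * l * v)"
    for x' x k l u v i j
    unfolding r1 c[OF E] by (simp add: right_diff_distrib mult.assoc add_diff_eq diff_diff_eq2)
  have e2: "(x' * E i j - x * E i j) / of_real dt = k * (u * E i j) \<longleftrightarrow> x' = x + of_real dt * k * u"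
    for x' x k u i j
    using c[OF E, of x' i j x "k * u"] by (simp only: mult.assoc)
  have e3: "(x' * E i j - x * E i j) / of_real dt = - (k * (u * E i j)) \<longleftrightarrow> x' = x - of_real dt * k * u"
    for x' x k u i j
    using e2[of x' i j x "- k" u] by simp
  show ?thesis
    unfolding scheme_def Dx_fourier_mode Dy_fourier_mode m e1 e2 e3 by blast
qed

lemma ex1_amplification_matrix:
  assumes "dt \<noteq> 0"
  shows "\<exists>!A. is_amplification_matrix dt dx dy \<beta>x \<beta>y A"
proof -
  define s where "s = of_real dt * symx dx \<beta>x \<beta>y"
  define t where "t = of_real dt * symx dy \<beta>y \<beta>x"
  define A where "A = mat_of_rows_list 3
    [[1, t, - s], [t, 1 + t * t, - (t * s)], [- s, - (s * t), 1 + s * s]]"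
  have A: "A \<in> carrier_mat 3 3"
    by (simp add: A_def mat_of_rows_list_def numeral_3_eq_3)
  have eq: "w = A *\<^sub>v v \<longleftrightarrow> w $ 0 = v $ 0 - (s * v $ 2 - t * v $ 1) \<and>
      w $ 1 = v $ 1 + t * w $ 0 \<and> w $ 2 = v $ 2 - s * w $ 0"
    if "v \<in> carrier_vec 3" "w \<in> carrier_vec 3" for v w
  proof -
    have all3: "(\<forall>i<3. P i) \<longleftrightarrow> P 0 \<and> P 1 \<and> P (2::nat)" for P
      by (auto simp: less_Suc_eq numeral_3_eq_3 numeral_2_eq_2)
    have set3: "{0..<3} = {0, 1, 2::nat}" by auto
    have "w = A *\<^sub>v v \<longleftrightarrow> (\<forall>i<3. w $ i = (A *\<^sub>v v) $ i)"
      using that A by (auto simp: vec_eq_iff)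
    also have "\<dots> \<longleftrightarrow> w $ 0 = v $ 0 - (s * v $ 2 - t * v $ 1) \<and>
      w $ 1 = v $ 1 + t * (v $ 0 - (s * v $ 2 - t * v $ 1)) \<and>
      w $ 2 = v $ 2 - s * (v $ 0 - (s * v $ 2 - t * v $ 1))"
      unfolding all3 using that
      by (simp add: A_def mat_of_rows_list_def scalar_prod_def set3 algebra_simps)
    also have "\<dots> \<longleftrightarrow> w $ 0 = v $ 0 - (s * v $ 2 - t * v $ 1) \<and>
      w $ 1 = v $ 1 + t * w $ 0 \<and> w $ 2 = v $ 2 - s * w $ 0"
      by metis
    finally show ?thesis .
  qed
  have ex: "is_amplification_matrix dt dx dy \<beta>x \<beta>y A"
    unfolding is_amplification_matrix_def scheme_fourier_mode[OF assms]
    using A eq by (auto simp: s_def t_def)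
  moreover have "A' = A" if A': "is_amplification_matrix dt dx dy \<beta>x \<beta>y A'" for A'
  proof (rule eq_matI)
    have c': "A' \<in> carrier_mat 3 3" using A' by (simp add: is_amplification_matrix_def)
    then show "dim_row A' = dim_row A" "dim_col A' = dim_col A" using A by auto
    fix i j assume ij: "i < dim_row A" "j < dim_col A"
    define q where "q = (\<lambda>n. ((*\<^sub>v) A ^^ n) (unit_vec 3 j))"
    have q: "q n \<in> carrier_vec 3" for n
      using A by (induction n) (auto simp: q_def)
    have step: "\<forall>n. q (Suc n) = A *\<^sub>v q n" by (simp add: q_def)
    then have "\<forall>n. q (Suc n) = A' *\<^sub>v q n"
      using ex A' q unfolding is_amplification_matrix_def by blast
    then have "A' *\<^sub>v q 0 = A *\<^sub>v q 0" using step by metis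
    then have "(A' *\<^sub>v unit_vec 3 j) $ i = (A *\<^sub>v unit_vec 3 j) $ i" by (simp add: q_def)
    then show "A' $$ (i, j) = A $$ (i, j)"
      using A c' ij by simp
  qed
  ultimately show ?thesis by blast
qed

end

theory Submission
  imports Defs
begin

text \<open>Let \<open>s\<close> and \<open>t\<close> be \<open>dt\<close> times the Fourier symbols of \<open>Dx\<close> and \<open>Dy\<close>. An eigenvector of the
  amplification matrix for \<open>\<mu>\<close> generates the Fourier mode solution with amplitude
  \<open>\<mu> ^ n\<close> times that vector; eliminating the electric amplitudes from the three scheme equations
  leaves \<open>(\<mu> - 1)\<^sup>2 = (s\<^sup>2 + t\<^sup>2) \<mu>\<close> unless \<open>\<mu> = 1\<close>. Central differences have imaginary symbols, so
  \<open>s\<^sup>2 + t\<^sup>2 = - K\<close> with a real \<open>K \<ge> 0\<close>, and the equation becomes \<open>\<mu>\<^sup>2 - (2 - K) \<mu> + 1 = 0\<close>. The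
  product of its roots is \<open>1\<close>; they are complex conjugate or coincide, hence lie on the unit circle,
  exactly when \<open>K \<le> 4\<close>.

  For equal spacings and \<open>a = cos \<beta>x\<close>, \<open>b = cos \<beta>y\<close>, \<open>K\<close> is \<open>(dt / dx)\<^sup>2 / 4\<close> times
  \<open>(1 - a\<^sup>2) (1 + b)\<^sup>2 + (1 - b\<^sup>2) (1 + a)\<^sup>2\<close>. Thanks to the transverse averaging the last
  expression never exceeds \<open>4\<close> (\<open>averaged_symbol_bound\<close>), so that \<open>K \<le> (dt / dx)\<^sup>2 < 4\<close>.\<close>

text \<open>Evolving the eigenvector itself for one step of the scheme avoids the entries of the matrix
  and its characteristic polynomial.\<close>

lemma eigenvalue_amplification_matrix:
  assumes dt: "dt \<noteq> 0"
    and "eigenvalue (amplification_matrix dt dx dy \<beta>x \<beta>y) \<mu>"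
  shows "\<mu> = 1 \<or> (\<mu> - 1)\<^sup>2 =
    ((of_real dt * symx dx \<beta>x \<beta>y)\<^sup>2 + (of_real dt * symx dy \<beta>y \<beta>x)\<^sup>2) * \<mu>"
proof -
  define A where "A = amplification_matrix dt dx dy \<beta>x \<beta>y"
  define s where "s = of_real dt * symx dx \<beta>x \<beta>y"
  define t where "t = of_real dt * symx dy \<beta>y \<beta>x"
  have A: "is_amplification_matrix dt dx dy \<beta>x \<beta>y A"
    unfolding A_def amplification_matrix_def
    by (rule theI'[OF ex1_amplification_matrix[OF dt]])
  then have A3: "A \<in> carrier_mat 3 3" by (simp add: is_amplification_matrix_def)
  obtain v where v3: "v \<in> carrier_vec 3" and v0: "v \<noteq> 0\<^sub>v 3" and Av: "A *\<^sub>v v = \<mu> \<cdot>\<^sub>v v"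
    using assms(2) A3 unfolding eigenvalue_def eigenvector_def A_def[symmetric] by auto
  define q where "q n = \<mu> ^ n \<cdot>\<^sub>v v" for n
  have "q (Suc n) = A *\<^sub>v q n" for n
    using A3 v3 by (simp add: q_def mult_mat_vec Av smult_smult_assoc mult.commute)
  moreover have "q n \<in> carrier_vec 3" for n using v3 by (simp add: q_def)
  ultimately have "scheme dt dx dy (\<lambda>n. fourier_mode \<beta>x \<beta>y (q n $ 0))
      (\<lambda>n. fourier_mode \<beta>x \<beta>y (q n $ 1)) (\<lambda>n. fourier_mode \<beta>x \<beta>y (q n $ 2))"
    using A unfolding is_amplification_matrix_def by blast
  then have "q 1 $ 0 = q 0 $ 0 - (s * q 0 $ 2 - t * q 0 $ 1) \<and>
      q 1 $ 1 = q 0 $ 1 + t * q 1 $ 0 \<and> q 1 $ 2 = q 0 $ 2 - s * q 1 $ 0"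
    unfolding scheme_fourier_mode[OF dt] s_def t_def One_nat_def by blast
  then have b: "(\<mu> - 1) * v $ 0 = t * v $ 1 - s * v $ 2"
    and ex: "(\<mu> - 1) * v $ 1 = t * \<mu> * v $ 0"
    and ey: "(\<mu> - 1) * v $ 2 = - (s * \<mu> * v $ 0)"
    using v3 by (simp_all add: q_def algebra_simps)
  have "\<mu> = 1" if "v $ 0 = 0"
  proof (rule ccontr)
    assume "\<mu> \<noteq> 1"
    then have "v $ 1 = 0" "v $ 2 = 0" using ex ey that by simp_all
    then have "v = 0\<^sub>v 3"
      using v3 that by (auto simp: vec_eq_iff less_Suc_eq numeral_3_eq_3 numeral_2_eq_2)
    with v0 show False ..
  qed
  moreover have "(\<mu> - 1)\<^sup>2 = (s\<^sup>2 + t\<^sup>2) * \<mu>" if "v $ 0 \<noteq> 0"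
  proof -
    have "(\<mu> - 1)\<^sup>2 * v $ 0 = t * ((\<mu> - 1) * v $ 1) - s * ((\<mu> - 1) * v $ 2)"
      by (simp only: power2_eq_square mult.assoc b) (simp add: algebra_simps)
    also have "\<dots> = (s\<^sup>2 + t\<^sup>2) * \<mu> * v $ 0"
      unfolding ex ey by (simp add: power2_eq_square algebra_simps)
    finally show ?thesis using that by simp
  qed
  ultimately show ?thesis unfolding s_def t_def by blast
qed

lemma symx_power2:
  "(symx dx \<beta>x \<beta>y)\<^sup>2 = - of_real ((1 - (cos \<beta>x)\<^sup>2) * (1 + cos \<beta>y)\<^sup>2 / (4 * dx\<^sup>2))"
proof -
  have e: "exp (\<i> * of_real x) = cis x" "exp (- (\<i> * of_real x)) = cis (- x)" for x
    by (simp_all add: cis_conv_exp)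
  have "symx dx \<beta>x \<beta>y = \<i> * of_real (sin \<beta>x * (1 + cos \<beta>y) / (2 * dx))"
  proof -
    have "cis \<beta>x - cis (- \<beta>x) = 2 * \<i> * of_real (sin \<beta>x)"
      and "cis \<beta>y + 2 + cis (- \<beta>y) = 2 * of_real (1 + cos \<beta>y)"
      by (simp_all add: complex_eq_iff)
    then show ?thesis
      unfolding symx_def e by (simp only:) (cases "dx = 0"; simp add: field_simps)
  qed
  then show ?thesis
    by (simp add: power_mult_distrib power_divide flip: sin_squared_eq)
qed

text \<open>With \<open>P = (1 + a) (1 + b)\<close>, the difference of the two sides is
  \<open>(P - 2)\<^sup>2 + P (1 - a) (1 - b)\<close>. Equality holds for instance at \<open>a = 1\<close>, \<open>b = 0\<close>, a mode that
  varies in one direction only, where averaging has no effect.\<close>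

lemma averaged_symbol_bound:
  fixes a b :: real
  assumes "\<bar>a\<bar> \<le> 1" "\<bar>b\<bar> \<le> 1"
  shows "(1 - a\<^sup>2) * (1 + b)\<^sup>2 + (1 - b\<^sup>2) * (1 + a)\<^sup>2 \<le> 4"
proof -
  have "4 - ((1 - a\<^sup>2) * (1 + b)\<^sup>2 + (1 - b\<^sup>2) * (1 + a)\<^sup>2) =
      ((1 + a) * (1 + b) - 2)\<^sup>2 + (1 + a) * (1 + b) * ((1 - a) * (1 - b))"
    by (simp add: power2_eq_square algebra_simps)
  moreover have "0 \<le> (1 + a) * (1 + b) * ((1 - a) * (1 - b))"
    using assms by (intro mult_nonneg_nonneg) auto
  ultimately show ?thesis
    using zero_le_power2[of "(1 + a) * (1 + b) - 2"] by linarith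
qed

text \<open>A nonreal root shares its real part \<open>c / 2\<close> with its conjugate, and their product is \<open>1\<close>;
  a real root forces the discriminant \<open>c\<^sup>2 - 4\<close> to vanish.\<close>

lemma cmod_root_reciprocal_quadratic:
  fixes c :: real
  assumes root: "\<mu>\<^sup>2 - of_real c * \<mu> + 1 = 0" and c: "\<bar>c\<bar> \<le> 2"
  shows "cmod \<mu> = 1"
proof -
  define x where "x = Re \<mu>"
  define y where "y = Im \<mu>"
  have re: "x\<^sup>2 - y\<^sup>2 - c * x + 1 = 0" and im: "y * (2 * x - c) = 0"
    using root by (auto simp: complex_eq_iff x_def y_def power2_eq_square algebra_simps)
  have c4: "c\<^sup>2 \<le> 4" using c abs_le_square_iff[of c 2] by simp
  have cx: "c = 2 * x"
  proof (cases "y = 0")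
    case True
    then have "(2 * x - c)\<^sup>2 = c\<^sup>2 - 4"
      using re by (simp add: power2_eq_square algebra_simps)
    then have "(2 * x - c)\<^sup>2 = 0" using c4 zero_le_power2[of "2 * x - c"] by linarith
    then show ?thesis by simp
  qed (use im in simp)
  have "y\<^sup>2 = 1 - x\<^sup>2"
    using re unfolding cx by (simp add: power2_eq_square)
  then show ?thesis by (simp add: cmod_def flip: x_def y_def)
qed

theorem corollaryB3:
  fixes dt dx dy :: real
  assumes "dt > 0" and "dx > 0" and "dy = dx"
    and "dt / dx < 2"
  shows "von_neumann_stable dt dx dy"
  unfolding von_neumann_stable_def
proof (intro allI impI)
  fix \<beta>x \<beta>y \<mu>
  assume ev: "eigenvalue (amplification_matrix dt dx dy \<beta>x \<beta>y) \<mu>"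
  define F where "F = (1 - (cos \<beta>x)\<^sup>2) * (1 + cos \<beta>y)\<^sup>2 + (1 - (cos \<beta>y)\<^sup>2) * (1 + cos \<beta>x)\<^sup>2"
  define K where "K = (dt / dx)\<^sup>2 * F / 4"
  have F0: "0 \<le> F"
    unfolding F_def by (auto intro!: add_nonneg_nonneg mult_nonneg_nonneg simp: abs_square_le_1)
  have F4: "F \<le> 4" unfolding F_def by (rule averaged_symbol_bound) simp_all
  have "(dt / dx)\<^sup>2 \<le> 2\<^sup>2" by (rule power_mono) (use assms in simp_all)
  then have "(dt / dx)\<^sup>2 * F \<le> 4 * 4" using F0 F4 by (intro mult_mono) simp_all
  then have K: "0 \<le> K" "K \<le> 4" using F0 by (simp_all add: K_def)
  have st: "(of_real dt * symx dx \<beta>x \<beta>y)\<^sup>2 + (of_real dt * symx dy \<beta>y \<beta>x)\<^sup>2 = - complex_of_real K"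
  proof -
    have "K = dt\<^sup>2 * ((1 - (cos \<beta>x)\<^sup>2) * (1 + cos \<beta>y)\<^sup>2 / (4 * dx\<^sup>2)) +
        dt\<^sup>2 * ((1 - (cos \<beta>y)\<^sup>2) * (1 + cos \<beta>x)\<^sup>2 / (4 * dx\<^sup>2))"
      by (simp add: K_def F_def power_divide add_divide_distrib distrib_left)
    then show ?thesis
      unfolding power_mult_distrib symx_power2 \<open>dy = dx\<close> by simp
  qed
  from eigenvalue_amplification_matrix[OF _ ev] assms
  consider "\<mu> = 1" | "(\<mu> - 1)\<^sup>2 = - of_real K * \<mu>"
    unfolding st by auto
  then show "cmod \<mu> \<le> 1"
  proof cases
    case 2
    then have "\<mu>\<^sup>2 - of_real (2 - K) * \<mu> + 1 = 0"
      by (simp add: power2_eq_square algebra_simps)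
    moreover have "\<bar>2 - K\<bar> \<le> 2" using K by simp
    ultimately have "cmod \<mu> = 1" by (rule cmod_root_reciprocal_quadratic)
    then show ?thesis by simp
  qed simp
qed

end
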